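(* Let $\mathbb K=\mathbb R$ or $\mathbb K=\mathbb C$, let $K\subseteq\mathbb K^n$ be compact and let $g\in C(K,\mathbb K)$. The following assertions are equivalent: (1) $C(K,\mathbb K)$ is $n$-stable at $g$, that is, $(\mathbf f,g)$ is reducible for every $\mathbf f=(f_1,\dots,f_n)\in C(K,\mathbb K^n)$ such that $(\mathbf f,g)\in U_{n+1}(C(K,\mathbb K))$. (2) $\mathbf f|_{Z(g)}$ admits a zero-free extension to $K$ for all $\mathbf f\in C(K,\mathbb K^n)$ with $Z(\mathbf f)\cap Z(g)=\emptyset$. (3) $g$ satisfies the boundary principle $(B_1)$. (4) $(Z(g),K)$ satisfies the hole condition.
   Context: $C(K,\mathbb K)$ is the algebra of continuous $\mathbb K$-valued functions on $K$ with the supremum norm, and $C(K,\mathbb K^n)=C(K,\mathbb K)^n$. $Z(g)=\{x\in K:g(x)=0\}$, and for $\mathbf f=(f_1,\dots,f_n)$, $Z(\mathbf f)=\bigcap_{j=1}^n Z(f_j)$. A zero-free extension of $\mathbf f|_{Z(g)}$ to $K$ is a continuous map $\mathbf F:K\to\mathbb K^n\setminus\{0\}$ with $\mathbf F=\mathbf f$ on $Z(g)$. For a commutative unital Banach algebra $A$, $U_m(A)$ is the set of tuples $(f_1,\dots,f_m)\in A^m$ for which there is $(x_1,\dots,x_m)\in A^m$ with $\sum_j x_jf_j=\mathbf 1$. $(\mathbf f,g)\in U_{n+1}(A)$, with $\mathbf f\in A^n$, is reducible if there is $\mathbf a\in A^n$ with $\mathbf f+g\,\mathbf a\in U_n(A)$.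 The following notions are used in $\mathbb R^N$, where $N=n$ if $\mathbb K=\mathbb R$ and $N=2n$ if $\mathbb K=\mathbb C$ (identifying $\mathbb C^n$ with $\mathbb R^{2n}$). For compact $L\subseteq\mathbb R^N$, a hole of $L$ is a bounded connected component of $\mathbb R^N\setminus L$. For compact sets $L\subseteq L'$ in $\mathbb R^N$, the pair $(L,L')$ satisfies the hole condition if every hole of $L$ contains a hole of $L'$. The function $g\in C(K,\mathbb K)$ satisfies the boundary principle $(B_1)$ if for every nonvoid open set $G$ in $\mathbb R^N$ with $G\subseteq K$: if $g\equiv0$ on $\partial G$, then $g\equiv0$ on $G$. *)

theory Defs
  imports "HOL-Analysis.Analysis" "HOL-Algebra.Ring"
begin

text \<open>
  A tuple of length \<open>m\<close> is a family indexed by a finite type with \<open>m\<close> elements. The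
  \<open>(n + 1)\<close>-tuple formed by an \<open>n\<close>-tuple \<open>f\<close> and a last entry \<open>g\<close> is \<open>case_option g f\<close>,
  which is indexed by \<open>'i option\<close>.
\<close>

definition unimodular :: "('a, 'b) ring_scheme \<Rightarrow> ('i::finite \<Rightarrow> 'a) set" where
  "unimodular A =
     {f \<in> UNIV \<rightarrow> carrier A.
        \<exists>x \<in> UNIV \<rightarrow> carrier A. (\<Oplus>\<^bsub>A\<^esub>j\<in>UNIV. x j \<otimes>\<^bsub>A\<^esub> f j) = \<one>\<^bsub>A\<^esub>}"

definition reducible :: "('a, 'b) ring_scheme \<Rightarrow> ('i::finite \<Rightarrow> 'a) \<Rightarrow> 'a \<Rightarrow> bool" where
  "reducible A f g \<longleftrightarrow>
     (\<exists>a \<in> UNIV \<rightarrow> carrier A. (\<lambda>j. f j \<oplus>\<^bsub>A\<^esub> g \<otimes>\<^bsub>A\<^esub> a j) \<in> unimodular A)"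

text \<open>The type argument fixes the length of the tuples, \<open>n = CARD('i)\<close>.\<close>

definition stable_at :: "'i::finite itself \<Rightarrow> ('a, 'b) ring_scheme \<Rightarrow> 'a \<Rightarrow> bool" where
  "stable_at _ A g \<longleftrightarrow>
     (\<forall>f \<in> (UNIV :: 'i set) \<rightarrow> carrier A.
        case_option g f \<in> unimodular A \<longrightarrow> reducible A f g)"

text \<open>
  The algebra \<open>C(K, \<bbbK>)\<close>. Its elements are functions on \<open>K\<close> only, so they are represented
  by functions that are \<open>undefined\<close> outside \<open>K\<close>. Unimodularity and reducibility involve
  only the ring structure, so the norm is not part of the record.
\<close>

definition cont_ring ::
    "'a::topological_space set \<Rightarrow> ('a \<Rightarrow> 'k::real_normed_field) ring" where
  "cont_ring K =
     \<lparr>carrier = {f \<in> extensional K. continuous_on K f},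
      mult = (\<lambda>f g. \<lambda>x\<in>K. f x * g x),
      one = (\<lambda>x\<in>K. 1),
      zero = (\<lambda>x\<in>K. 0),
      add = (\<lambda>f g. \<lambda>x\<in>K. f x + g x)\<rparr>"

lemma cring_cont_ring:
  fixes K :: "'a::topological_space set"
  shows "cring (cont_ring K :: ('a \<Rightarrow> 'k::real_normed_field) ring)"
proof (rule cringI)
  let ?R = "cont_ring K :: ('a \<Rightarrow> 'k) ring"
  show "abelian_group ?R"
  proof (rule abelian_groupI)
    fix f :: "'a \<Rightarrow> 'k" assume f: "f \<in> carrier ?R"
    have "(\<lambda>x\<in>K. - f x) \<in> carrier ?R"
      using f by (auto simp: cont_ring_def cong: continuous_on_cong intro: continuous_on_minus)
    moreover have "(\<lambda>x\<in>K. - f x) \<oplus>\<^bsub>?R\<^esub> f = \<zero>\<^bsub>?R\<^esub>"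
      by (auto simp: cont_ring_def)
    ultimately show "\<exists>h\<in>carrier ?R. h \<oplus>\<^bsub>?R\<^esub> f = \<zero>\<^bsub>?R\<^esub>"
      by blast
  qed (auto simp: cont_ring_def add_ac extensional_def fun_eq_iff
         cong: continuous_on_cong intro: continuous_on_add)
  show "Group.comm_monoid ?R"
    by (rule comm_monoidI)
      (auto simp: cont_ring_def mult_ac extensional_def fun_eq_iff
         cong: continuous_on_cong intro: continuous_on_mult)
qed (auto simp: cont_ring_def algebra_simps)

definition zeros :: "'a set \<Rightarrow> ('a \<Rightarrow> 'k::zero) \<Rightarrow> 'a set" where
  "zeros K g = {x \<in> K. g x = 0}"

definition tuple_zeros :: "'a set \<Rightarrow> ('i::finite \<Rightarrow> 'a \<Rightarrow> 'k::zero) \<Rightarrow> 'a set" where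
  "tuple_zeros K f = (\<Inter>j. zeros K (f j))"

definition zero_free_extension ::
    "'a::topological_space set \<Rightarrow> ('a \<Rightarrow> 'k::real_normed_field) \<Rightarrow>
     ('i::finite \<Rightarrow> 'a \<Rightarrow> 'k) \<Rightarrow> ('a \<Rightarrow> 'k ^ 'i) \<Rightarrow> bool" where
  "zero_free_extension K g f F \<longleftrightarrow>
     continuous_on K F \<and> F \<in> K \<rightarrow> - {0} \<and> (\<forall>x \<in> zeros K g. F x = (\<chi> j. f j x))"

text \<open>
  Holes and the boundary principle refer to an arbitrary Euclidean space. In particular they
  apply to \<open>complex ^ 'i\<close>, which as a real Euclidean space has dimension \<open>2 * CARD('i)\<close>
  and carries the norm of \<open>\<real>\<close> to the power \<open>2 * CARD('i)\<close>.
\<close>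

definition holes :: "'a::euclidean_space set \<Rightarrow> 'a set set" where
  "holes L = {H \<in> components (- L). bounded H}"

definition hole_condition :: "'a::euclidean_space set \<Rightarrow> 'a set \<Rightarrow> bool" where
  "hole_condition L L' \<longleftrightarrow> (\<forall>H \<in> holes L. \<exists>H' \<in> holes L'. H' \<subseteq> H)"

definition boundary_principle ::
    "'a::euclidean_space set \<Rightarrow> ('a \<Rightarrow> 'k::zero) \<Rightarrow> bool" where
  "boundary_principle K g \<longleftrightarrow>
     (\<forall>G. open G \<and> G \<noteq> {} \<and> G \<subseteq> K \<longrightarrow>
        (\<forall>x \<in> frontier G. g x = 0) \<longrightarrow> (\<forall>x \<in> G. g x = 0))"

end

theory Submission
  imports Defs
begin

text \<open>
  Let \<open>L\<close> be the zero set of \<open>g\<close>. An open \<open>G \<subseteq> K\<close> with boundary in \<open>L\<close> but \<open>G\<close> not contained in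
  \<open>L\<close> exists if and only if some hole of \<open>L\<close> lies inside \<open>K\<close>. In such a \<open>G\<close> the map \<open>x \<mapsto> x - p\<close> with
  \<open>p \<in> G - L\<close> has no zero-free extension from \<open>L\<close> to \<open>K\<close>, by the no-retraction theorem. If
  there is no such hole, the normalized map \<open>L \<rightarrow> S\<close> extends to the complement of a finite
  set of poles placed outside \<open>K\<close>, one in each relevant hole of \<open>L\<close>. Finally, a zero-free extension
  \<open>F\<close> of \<open>f\<close> makes \<open>f + g a\<close> zero-free for
  \<open>a = (F - f) cnj g / (\<bar>g\<bar>\<^sup>2 + \<epsilon>)\<close> with small \<open>\<epsilon>\<close>.
\<close>

section \<open>Holes of the zero set and the boundary principle\<close>

lemma closed_zeros:
  fixes g :: "'a::t2_space \<Rightarrow> 'k::{zero,t1_space}"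
  assumes "compact K" "continuous_on K g"
  shows "closed (zeros K g)"
proof -
  have "zeros K g = K \<inter> g -` {0}" by (auto simp: zeros_def)
  then show ?thesis
    using continuous_closed_preimage[OF assms(2) compact_imp_closed[OF assms(1)]] by simp
qed

text \<open>Components of the complement of a closed set are open with frontier in that set. Hence a
  hole of \<open>zeros K g\<close> lying inside \<open>K\<close> is itself an open set violating the
  boundary principle, and conversely every violating open set contains such a hole.\<close>

lemma boundary_principle_iff_hole_condition:
  fixes K :: "'a::euclidean_space set" and g :: "'a \<Rightarrow> 'k::zero"
  assumes "compact K" "closed (zeros K g)"
  shows "boundary_principle K g \<longleftrightarrow> hole_condition (zeros K g) K"
proof
  let ?L = "zeros K g"
  have LK: "?L \<subseteq> K" by (auto simp: zeros_def)
  {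
    assume bp: "boundary_principle K g"
    show "hole_condition ?L K"
      unfolding hole_condition_def
    proof
      fix H assume "H \<in> holes ?L"
      then have H: "H \<in> components (- ?L)" "bounded H" by (auto simp: holes_def)
      have Hne: "H \<noteq> {}" "H \<subseteq> - ?L" and "open H"
        using H assms(2) in_components_nonempty in_components_subset open_components by blast+
      have "frontier H \<subseteq> ?L"
        using frontier_of_components_closed_complement[OF assms(2) H(1)] .
      then have "\<not> H \<subseteq> K"
        using bp Hne \<open>open H\<close> unfolding boundary_principle_def zeros_def by blast
      then obtain x where x: "x \<in> H" "x \<notin> K" by blast
      \<comment> \<open>This component is connected and avoids the zero set, so it stays inside
        \<open>H\<close> and inherits its boundedness: it is the required hole of
        \<open>K\<close>.\<close>
      let ?C = "connected_component_set (- K) x"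
      have C: "?C \<in> components (- K)" using x by (auto simp: components_def)
      have "?C \<subseteq> - K" by (rule connected_component_subset)
      then have "?C \<subseteq> H"
        using LK x components_maximal[OF H(1) connected_connected_component[of "- K" x]]
        connected_component_refl[of x "- K"] by blast
      then show "\<exists>H'\<in>holes K. H' \<subseteq> H"
        using C H(2) bounded_subset by (auto simp: holes_def)
    qed
  }
  {
    assume hc: "hole_condition ?L K"
    show "boundary_principle K g"
      unfolding boundary_principle_def
    proof (intro allI impI ballI, rule ccontr)
      fix G x
      assume G: "open G \<and> G \<noteq> {} \<and> G \<subseteq> K" and fr: "\<forall>x\<in>frontier G. g x = 0"
        and x: "x \<in> G" "g x \<noteq> 0"
      have "frontier G \<subseteq> K"
        using G assms(1) closure_minimal[of G K] by (auto simp: frontier_def compact_imp_closed)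
      then have fL: "frontier G \<subseteq> ?L" using fr by (auto simp: zeros_def)
      let ?H = "connected_component_set (- ?L) x"
      have xL: "x \<in> - ?L" using x by (auto simp: zeros_def)
      have HL: "?H \<subseteq> - ?L" by (rule connected_component_subset)
      \<comment> \<open>A connected set that meets \<open>G\<close> and leaves it must meet
        \<open>frontier G\<close>, but \<open>?H\<close> avoids the zero set, which contains this
        frontier.\<close>
      have "?H \<subseteq> G"
      proof (rule ccontr)
        assume "\<not> ?H \<subseteq> G"
        moreover have "x \<in> ?H" using xL connected_component_refl[of x "- ?L"] by simp
        ultimately have "?H \<inter> frontier G \<noteq> {}"
          using x(1) by (intro connected_Int_frontier connected_connected_component) blast+
        then show False using fL HL by blast
      qed
      then have "?H \<subseteq> K" using G by blast
      moreover from this have "bounded ?H"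
        using assms(1) bounded_subset compact_imp_bounded by blast
      then have "?H \<in> holes ?L" using xL by (auto simp: holes_def components_def)
      then obtain H' where "H' \<in> holes K" "H' \<subseteq> ?H"
        using hc unfolding hole_condition_def by blast
      ultimately show False
        using in_components_nonempty[of H' "- K"] in_components_subset[of H' "- K"]
        by (auto simp: holes_def)
    qed
  }
qed

section \<open>Obstruction and extension for zero-free maps in Euclidean space\<close>

text \<open>Continued by the translation outside \<open>G\<close>, such an \<open>F\<close> would
  become a zero-free map of the whole space that equals \<open>x - p\<close> far out. Its radial
  projection would retract a ball onto its sphere.\<close>

lemma no_zero_free_extension_of_translation:
  fixes F :: "'a::euclidean_space \<Rightarrow> 'a"
  assumes G: "open G" "bounded G" "p \<in> G"
    and F: "continuous_on (closure G) F" "\<And>x. x \<in> closure G \<Longrightarrow> F x \<noteq> 0"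
    and fr: "\<And>x. x \<in> frontier G \<Longrightarrow> F x = x - p"
  shows False
proof -
  obtain r where r: "r > 0" "closure G \<subseteq> ball p r"
    using bounded_closure[OF G(2)] bounded_subset_ballD by blast
  \<comment> \<open>The closed sets \<open>closure G\<close> and \<open>- G\<close> overlap only in
    \<open>frontier G\<close>, where both formulas agree by \<open>fr\<close>. The translation
    vanishes only at \<open>p\<close>, which lies in \<open>G\<close>, so \<open>h\<close> has no
    zero.\<close>
  define h where "h x = (if x \<in> closure G then F x else x - p)" for x
  have "continuous_on (closure G \<union> - G) h"
    unfolding h_def
  proof (rule continuous_on_cases)
    show "closed (- G)" using G(1) by (rule closed_Compl)
    show "\<forall>x. x \<in> closure G \<and> x \<notin> closure G \<or> x \<in> - G \<and> x \<in> closure G \<longrightarrow> F x = x - p"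
      using fr G(1) by (auto simp: frontier_def interior_open)
  qed (auto intro!: continuous_intros F)
  moreover have "closure G \<union> - G = UNIV" using closure_subset by blast
  ultimately have contH: "continuous_on UNIV h" by simp
  have hne: "h x \<noteq> 0" for x
    using F(2) G(3) closure_subset by (auto simp: h_def)
  \<comment> \<open>The sphere of radius \<open>r\<close> about \<open>p\<close> lies outside
    \<open>closure G\<close>. There \<open>h x = x - p\<close> has norm \<open>r\<close>, so
    \<open>k\<close> fixes the sphere pointwise.\<close>
  define k where "k x = p + r *\<^sub>R (h x /\<^sub>R norm (h x))" for x
  have "retraction (cball p r) (sphere p r) k"
    unfolding retraction_def
  proof (intro conjI ballI)
    show "continuous_on (cball p r) k"
      unfolding k_def using hne
      by (intro continuous_intros continuous_on_subset[OF contH]) auto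
    show "k \<in> cball p r \<rightarrow> sphere p r"
      using r hne by (auto simp: k_def dist_norm)
    fix x assume x: "x \<in> sphere p r"
    then have "x \<notin> closure G" using r by auto
    then show "k x = x" using x r by (auto simp: k_def h_def dist_norm norm_minus_commute)
  qed auto
  then show False
    using no_retraction_cball[OF r(1), of p] by (auto simp: retract_of_def)
qed

text \<open>A map from a compact set to the unit sphere of the same Euclidean space extends to the
  complement of a set of poles, which can be chosen in any set meeting all holes. The hole condition
  makes \<open>- K\<close> such a set, so the direction of \<open>f\<close> extends to
  \<open>K\<close>; the modulus is then restored.\<close>

lemma zero_free_extension_if_hole_condition:
  fixes f :: "'a::euclidean_space \<Rightarrow> 'a"
  assumes L: "compact L" "L \<subseteq> K"
    and f: "continuous_on K f" "\<And>x. x \<in> L \<Longrightarrow> f x \<noteq> 0"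
    and hc: "hole_condition L K"
  obtains F where "continuous_on K F" "\<And>x. x \<in> K \<Longrightarrow> F x \<noteq> 0" "\<And>x. x \<in> L \<Longrightarrow> F x = f x"
proof -
  have fL: "continuous_on L f" using f(1) L(2) continuous_on_subset by blast
  let ?u = "\<lambda>x. f x /\<^sub>R norm (f x)"
  have u: "continuous_on L ?u" "?u \<in> L \<rightarrow> sphere (0::'a) 1"
    using f(2) by (auto intro!: continuous_intros fL)
  have poles: "C \<inter> (- K) \<noteq> {}" if "C \<in> components (- L)" "bounded C" for C
  proof -
    have "C \<in> holes L" using that by (auto simp: holes_def)
    then obtain H where "H \<in> holes K" "H \<subseteq> C" using hc unfolding hole_condition_def by blast
    then show ?thesis
      using in_components_nonempty[of H "- K"] in_components_subset[of H "- K"]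
      by (auto simp: holes_def)
  qed
  \<comment> \<open>Domain and value space coincide, so the dimension hypothesis of the extension
    theorem holds by \<open>order_refl\<close>. As \<open>P\<close> lies outside \<open>K\<close>,
    \<open>v\<close> is continuous on all of \<open>K\<close>.\<close>
  obtain P v where P: "P \<subseteq> - K" "continuous_on (- P) v" "v \<in> (- P) \<rightarrow> sphere (0::'a) 1"
    "\<And>x. x \<in> L \<Longrightarrow> v x = ?u x"
    using extend_map_UNIV_to_sphere_cofinite[OF order_refl zero_le_one L(1) u poles] by metis
  have vK: "continuous_on K v" "\<And>x. x \<in> K \<Longrightarrow> norm (v x) = 1"
    using P by (auto intro: continuous_on_subset)
  \<comment> \<open>With this lower bound the factor \<open>max c (norm (f x))\<close> is positive
    on \<open>K\<close>, even at zeros of \<open>f\<close>, and is exactly \<open>norm (f x)\<close>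
    on \<open>L\<close>. For empty \<open>L\<close> any positive value works.\<close>
  obtain c where c: "c > 0" "\<And>x. x \<in> L \<Longrightarrow> c \<le> norm (f x)"
  proof (cases "L = {}")
    case True
    then show ?thesis using that[of 1] by auto
  next
    case False
    then obtain m where "m \<in> L" "\<forall>x\<in>L. norm (f m) \<le> norm (f x)"
      using continuous_attains_inf[OF L(1), of "\<lambda>x. norm (f x)"] fL continuous_on_norm by blast
    then show ?thesis using that[of "norm (f m)"] f(2) by auto
  qed
  show ?thesis
  proof
    show "continuous_on K (\<lambda>x. max c (norm (f x)) *\<^sub>R v x)"
      by (intro continuous_intros vK f)
    show "max c (norm (f x)) *\<^sub>R v x \<noteq> 0" if "x \<in> K" for x
      using vK(2)[OF that] c(1) by auto
    show "max c (norm (f x)) *\<^sub>R v x = f x" if "x \<in> L" for x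
      using P(4)[OF that] c(2)[OF that] f(2)[OF that] by (simp add: max_absorb2)
  qed
qed

section \<open>Unimodularity and reducibility as pointwise conditions\<close>

lemma finsum_cont_ring:
  fixes x :: "'i \<Rightarrow> 'a::topological_space \<Rightarrow> 'k::real_normed_field"
  assumes "finite A" "x \<in> A \<rightarrow> carrier (cont_ring K)"
  shows "(\<Oplus>\<^bsub>cont_ring K\<^esub>j\<in>A. x j) = (\<lambda>t\<in>K. \<Sum>j\<in>A. x j t)"
proof -
  interpret cring "cont_ring K :: ('a \<Rightarrow> 'k) ring" by (rule cring_cont_ring)
  show ?thesis using assms
  proof (induction A)
    case empty
    have "(\<Oplus>\<^bsub>cont_ring K\<^esub>j\<in>{}. x j) = \<zero>\<^bsub>cont_ring K\<^esub>" by (rule finsum_empty)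
    then show ?case by (simp add: cont_ring_def)
  next
    case (insert a A)
    then have "(\<Oplus>\<^bsub>cont_ring K\<^esub>j\<in>insert a A. x j)
        = x a \<oplus>\<^bsub>cont_ring K\<^esub> (\<Oplus>\<^bsub>cont_ring K\<^esub>j\<in>A. x j)"
      by (intro finsum_insert) auto
    also have "(\<Oplus>\<^bsub>cont_ring K\<^esub>j\<in>A. x j) = (\<lambda>t\<in>K. \<Sum>j\<in>A. x j t)"
      using insert by auto
    finally show ?case using insert by (auto simp: cont_ring_def fun_eq_iff)
  qed
qed

text \<open>Treats the identity of \<open>\<real>\<close> and the complex conjugation at once.\<close>

locale conjugation =
  fixes cj :: "'k::{real_normed_field,euclidean_space} \<Rightarrow> 'k"
  assumes continuous_cj: "continuous_on UNIV cj"
    and cj_mult: "cj z * z = of_real ((norm z)\<^sup>2)"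
begin

lemma continuous_on_cj:
  assumes "continuous_on S f"
  shows "continuous_on S (\<lambda>x. cj (f x))"
  by (rule continuous_on_compose2[OF continuous_cj assms]) auto

text \<open>At a common zero every combination of the entries vanishes, so it cannot be the unit.
  Without common zeros the sum of the squared moduli is invertible, and the conjugated entries
  divided by it are Bezout coefficients.\<close>

lemma unimodular_cont_ring_iff:
  fixes K :: "'a::topological_space set" and f :: "'i::finite \<Rightarrow> 'a \<Rightarrow> 'k"
  assumes "f \<in> UNIV \<rightarrow> carrier (cont_ring K)"
  shows "f \<in> unimodular (cont_ring K) \<longleftrightarrow> tuple_zeros K f = {}"
proof -
  interpret cring "cont_ring K :: ('a \<Rightarrow> 'k) ring" by (rule cring_cont_ring)
  have sum: "(\<Oplus>\<^bsub>cont_ring K\<^esub>j\<in>UNIV. x j \<otimes>\<^bsub>cont_ring K\<^esub> f j) = (\<lambda>t\<in>K. \<Sum>j\<in>UNIV. x j t * f j t)"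
    if "x \<in> UNIV \<rightarrow> carrier (cont_ring K)" for x
  proof -
    have "(\<Oplus>\<^bsub>cont_ring K\<^esub>j\<in>UNIV. x j \<otimes>\<^bsub>cont_ring K\<^esub> f j)
        = (\<lambda>t\<in>K. \<Sum>j\<in>UNIV. (x j \<otimes>\<^bsub>cont_ring K\<^esub> f j) t)"
      using that assms by (intro finsum_cont_ring) auto
    then show ?thesis by (auto simp: cont_ring_def fun_eq_iff)
  qed
  show ?thesis
  proof
    assume "f \<in> unimodular (cont_ring K)"
    then obtain x where x: "x \<in> UNIV \<rightarrow> carrier (cont_ring K)"
      "(\<lambda>t\<in>K. \<Sum>j\<in>UNIV. x j t * f j t) = \<one>\<^bsub>cont_ring K\<^esub>"
      using sum by (auto simp: unimodular_def)
    show "tuple_zeros K f = {}"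
    proof (rule equals0I)
      fix t assume t: "t \<in> tuple_zeros K f"
      then have "t \<in> K" "\<And>j. f j t = 0" by (auto simp: tuple_zeros_def zeros_def)
      then show False using fun_cong[OF x(2), of t] by (simp add: cont_ring_def)
    qed
  next
    assume z: "tuple_zeros K f = {}"
    let ?s = "\<lambda>t. \<Sum>j\<in>UNIV. (norm (f j t))\<^sup>2"
    have s: "?s t \<noteq> 0" if "t \<in> K" for t
    proof
      assume "?s t = 0"
      then have "\<And>j. f j t = 0" by (simp add: sum_nonneg_eq_0_iff)
      then show False using z that by (auto simp: tuple_zeros_def zeros_def)
    qed
    have fc: "continuous_on K (f j)" for j using assms by (auto simp: cont_ring_def)
    define x where "x j = (\<lambda>t\<in>K. cj (f j t) * of_real (inverse (?s t)))" for j
    have "x j \<in> carrier (cont_ring K)" for j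
    proof -
      have "continuous_on K (\<lambda>t. cj (f j t) * of_real (inverse (?s t)))"
        using s by (intro continuous_intros continuous_on_cj fc) auto
      then show ?thesis by (auto simp: cont_ring_def x_def cong: continuous_on_cong)
    qed
    moreover have "(\<Sum>j\<in>UNIV. x j t * f j t) = 1" if "t \<in> K" for t
    proof -
      have "(\<Sum>j\<in>UNIV. x j t * f j t) = (\<Sum>j\<in>UNIV. of_real (inverse (?s t)) * (cj (f j t) * f j t))"
        using that by (intro sum.cong) (auto simp: x_def mult_ac)
      also have "\<dots> = of_real (inverse (?s t)) * of_real (?s t)"
        unfolding cj_mult by (simp only: sum_distrib_left[symmetric] of_real_sum)
      also have "\<dots> = 1" using s[OF that] by (metis left_inverse of_real_1 of_real_mult)
      finally show ?thesis .
    qed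
    then have "(\<lambda>t\<in>K. \<Sum>j\<in>UNIV. x j t * f j t) = \<one>\<^bsub>cont_ring K\<^esub>"
      by (auto simp: cont_ring_def fun_eq_iff)
    ultimately show "f \<in> unimodular (cont_ring K)"
      using assms sum[of x] by (auto simp: unimodular_def)
  qed
qed

lemma unimodular_case_option_iff:
  fixes K :: "'a::topological_space set" and f :: "'i::finite \<Rightarrow> 'a \<Rightarrow> 'k"
  assumes "f \<in> UNIV \<rightarrow> carrier (cont_ring K)" "g \<in> carrier (cont_ring K)"
  shows "case_option g f \<in> unimodular (cont_ring K) \<longleftrightarrow> tuple_zeros K f \<inter> zeros K g = {}"
proof -
  have "case_option g f \<in> UNIV \<rightarrow> carrier (cont_ring K)"
    using assms by (auto simp: Pi_iff split: option.split)
  moreover have "tuple_zeros K (case_option g f) = tuple_zeros K f \<inter> zeros K g"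
    by (auto simp: tuple_zeros_def UNIV_option_conv)
  ultimately show ?thesis by (simp add: unimodular_cont_ring_iff)
qed

text \<open>Translates the ring condition into analysis: the coefficients may be arbitrary outside
  \<open>K\<close>, which spares later arguments the extensional representation.\<close>

lemma reducible_cont_ring_iff:
  fixes K :: "'a::topological_space set" and f :: "'i::finite \<Rightarrow> 'a \<Rightarrow> 'k"
  assumes "f \<in> UNIV \<rightarrow> carrier (cont_ring K)" "g \<in> carrier (cont_ring K)"
  shows "reducible (cont_ring K) f g \<longleftrightarrow>
    (\<exists>a. (\<forall>j. continuous_on K (a j)) \<and> (\<forall>t\<in>K. \<exists>j. f j t + g t * a j t \<noteq> 0))"
    (is "_ \<longleftrightarrow> (\<exists>a. ?Q a)")
proof -
  interpret cring "cont_ring K :: ('a \<Rightarrow> 'k) ring" by (rule cring_cont_ring)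
  have *: "(\<lambda>j. f j \<oplus>\<^bsub>cont_ring K\<^esub> g \<otimes>\<^bsub>cont_ring K\<^esub> a j) \<in> unimodular (cont_ring K)
      \<longleftrightarrow> (\<forall>t\<in>K. \<exists>j. f j t + g t * a j t \<noteq> 0)"
    if "a \<in> UNIV \<rightarrow> carrier (cont_ring K)" for a
  proof -
    have "(\<lambda>j. f j \<oplus>\<^bsub>cont_ring K\<^esub> g \<otimes>\<^bsub>cont_ring K\<^esub> a j) \<in> UNIV \<rightarrow> carrier (cont_ring K)"
      using that assms by auto
    then show ?thesis
      by (subst unimodular_cont_ring_iff)
        (auto simp: tuple_zeros_def zeros_def cont_ring_def)
  qed
  show ?thesis
  proof
    assume "reducible (cont_ring K) f g"
    then obtain a where a: "a \<in> UNIV \<rightarrow> carrier (cont_ring K)"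
      "(\<lambda>j. f j \<oplus>\<^bsub>cont_ring K\<^esub> g \<otimes>\<^bsub>cont_ring K\<^esub> a j) \<in> unimodular (cont_ring K)"
      unfolding reducible_def by blast
    then have "?Q a" using *[OF a(1)] by (auto simp: cont_ring_def)
    then show "\<exists>a. ?Q a" by blast
  next
    assume "\<exists>a. ?Q a"
    then obtain a where a: "?Q a" by blast
    define b where "b j = restrict (a j) K" for j
    have b: "b \<in> UNIV \<rightarrow> carrier (cont_ring K)"
      using a by (auto simp: b_def cont_ring_def cong: continuous_on_cong)
    have "\<forall>t\<in>K. \<exists>j. f j t + g t * b j t \<noteq> 0" using a by (simp add: b_def)
    then show "reducible (cont_ring K) f g"
      unfolding reducible_def using *[OF b] b by blast
  qed
qed

section \<open>Reducibility versus zero-free extension\<close>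

text \<open>The quotient \<open>(F - f) / g\<close> would give \<open>F\<close> exactly but need not
  be continuous at zeros of \<open>g\<close>. Regularizing it costs an error that is a fraction of
  \<open>F - f\<close>: this is harmless where \<open>F - f\<close> is small, and elsewhere
  \<open>g\<close> is bounded away from zero, which makes the fraction small.\<close>

lemma exists_zero_free_perturbation:
  fixes f F :: "'a::topological_space \<Rightarrow> 'k ^ 'n" and g :: "'a \<Rightarrow> 'k"
  assumes K: "compact K" and cont: "continuous_on K f" "continuous_on K F" "continuous_on K g"
    and F: "\<And>x. x \<in> K \<Longrightarrow> F x \<noteq> 0" "\<And>x. x \<in> K \<Longrightarrow> g x = 0 \<Longrightarrow> F x = f x"
  obtains a where "continuous_on K a" "\<And>x. x \<in> K \<Longrightarrow> f x + (\<chi> j. g x * a x $ j) \<noteq> 0"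
proof (cases "K = {}")
  case True
  then show ?thesis using that by simp
next
  case False
  let ?h = "\<lambda>x. F x - f x"
  have hc: "continuous_on K ?h" by (intro continuous_intros cont)
  have "continuous_on K (\<lambda>x. norm (F x))" by (intro continuous_intros cont)
  from continuous_attains_inf[OF K False this]
  obtain d where d: "d > 0" "\<And>x. x \<in> K \<Longrightarrow> d \<le> norm (F x)"
    using F(1) by (metis zero_less_norm_iff)
  have "continuous_on K (\<lambda>x. norm (?h x))" by (intro continuous_intros cont)
  from continuous_attains_sup[OF K False this]
  obtain M where M: "M \<ge> 0" "\<And>x. x \<in> K \<Longrightarrow> norm (?h x) \<le> M" by (metis norm_ge_zero)
  \<comment> \<open>Here the error needs control. \<open>S\<close> contains no zero of
    \<open>g\<close>, since \<open>F\<close> and \<open>f\<close> agree at such points while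
    \<open>d > 0\<close>; compactness then bounds \<open>g\<close> away from zero on
    \<open>S\<close>.\<close>
  define S where "S = {x \<in> K. d \<le> norm (?h x)}"
  have S: "compact S"
  proof -
    have "S = K \<inter> (\<lambda>x. norm (?h x)) -` {d..}" by (auto simp: S_def)
    moreover have "closedin (top_of_set K) (K \<inter> (\<lambda>x. norm (?h x)) -` {d..})"
      by (intro continuous_closedin_preimage continuous_on_norm hc) auto
    ultimately show ?thesis using K closedin_compact by metis
  qed
  obtain m where m: "m > 0" "\<And>x. x \<in> S \<Longrightarrow> m \<le> (norm (g x))\<^sup>2"
  proof (cases "S = {}")
    case True
    then show ?thesis using that[of 1] by auto
  next
    case ne: False
    have "continuous_on S (\<lambda>x. (norm (g x))\<^sup>2)"
      by (intro continuous_intros continuous_on_subset[OF cont(3)]) (auto simp: S_def)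
    from continuous_attains_inf[OF S ne this]
    obtain y where y: "y \<in> S" "\<And>x. x \<in> S \<Longrightarrow> (norm (g y))\<^sup>2 \<le> (norm (g x))\<^sup>2" by blast
    have "g y \<noteq> 0" using y(1) F(2)[of y] d(1) by (auto simp: S_def)
    then show ?thesis using that[of "(norm (g y))\<^sup>2"] y by auto
  qed
  \<comment> \<open>Chosen so that \<open>e / m * M = d * (M / (M + 1)) < d\<close>; the summand 1
    gives strictness and covers \<open>M = 0\<close>.\<close>
  define e where "e = m * d / (M + 1)"
  have e: "e > 0" using m d M by (simp add: e_def)
  let ?q = "\<lambda>x. (norm (g x))\<^sup>2 + e"
  have q: "?q x > 0" for x using e by (simp add: add_nonneg_pos)
  define a where "a x = (\<chi> j. cj (g x) * of_real (inverse (?q x)) * ?h x $ j)" for x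
  have ga: "g x * a x $ j = ((norm (g x))\<^sup>2 / ?q x) *\<^sub>R (?h x $ j)" for x j
  proof -
    have "g x * a x $ j = (cj (g x) * g x) * of_real (inverse (?q x)) * ?h x $ j"
      by (simp add: a_def mult_ac)
    then show ?thesis
      by (simp add: cj_mult scaleR_conv_of_real divide_inverse del: vector_minus_component)
  qed
  show ?thesis
  proof
    show "continuous_on K a"
      unfolding a_def using q
      by (intro continuous_intros continuous_on_cj cont) (metis less_irrefl)
    fix x assume x: "x \<in> K"
    have "(norm (g x))\<^sup>2 / ?q x = 1 - e / ?q x" using q[of x] by (simp add: field_simps)
    then have "f x + (\<chi> j. g x * a x $ j) = f x + (1 - e / ?q x) *\<^sub>R ?h x"
      by (simp add: vec_eq_iff ga)
    also have "\<dots> = F x - (e / ?q x) *\<^sub>R ?h x" by (simp add: algebra_simps)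
    finally have eq: "f x + (\<chi> j. g x * a x $ j) = F x - (e / ?q x) *\<^sub>R ?h x" .
    \<comment> \<open>Off \<open>S\<close> the factor is at most 1 and \<open>F - f\<close> is
      already shorter than \<open>d\<close>. On \<open>S\<close> the factor is at most
      \<open>e / m\<close>. As \<open>F x\<close> has norm at least \<open>d\<close>, the error
      cannot cancel it.\<close>
    have "norm ((e / ?q x) *\<^sub>R ?h x) < d"
    proof (cases "x \<in> S")
      case False
      have "0 \<le> e / ?q x" "e / ?q x \<le> 1" using q[of x] e by auto
      then have "norm ((e / ?q x) *\<^sub>R ?h x) \<le> norm (?h x)"
        unfolding norm_scaleR by (metis abs_of_nonneg mult_left_le_one_le norm_ge_zero)
      also have "\<dots> < d" using False x by (auto simp: S_def)
      finally show ?thesis .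
    next
      case True
      have "e / ?q x \<le> e / m"
        using m(2)[OF True] e m(1) by (intro divide_left_mono) (auto simp: add_nonneg_pos)
      then have "(e / ?q x) * norm (?h x) \<le> e / m * M"
        using M x e m(1) q[of x] by (intro mult_mono) auto
      also have "\<dots> = d * (M / (M + 1))" using m by (simp add: e_def)
      also have "\<dots> < d * 1" using d M by (intro mult_strict_left_mono) auto
      finally show ?thesis using q[of x] e by simp
    qed
    then show "f x + (\<chi> j. g x * a x $ j) \<noteq> 0" using eq d(2)[OF x] by (metis eq_iff_diff_eq_0 not_le)
  qed
qed

text \<open>The equivalence holds for each tuple separately: \<open>f + g a\<close> is itself a
  zero-free extension because it equals \<open>f\<close> where \<open>g\<close> vanishes, and the
  converse is the perturbation argument.\<close>

lemma stable_at_iff_zero_free_extension: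
  fixes K :: "'a::topological_space set" and g :: "'a \<Rightarrow> 'k"
  assumes K: "compact K" and g: "g \<in> carrier (cont_ring K)"
  shows "stable_at TYPE('n::finite) (cont_ring K) g \<longleftrightarrow>
    (\<forall>f \<in> (UNIV :: 'n set) \<rightarrow> carrier (cont_ring K).
       tuple_zeros K f \<inter> zeros K g = {} \<longrightarrow> (\<exists>F. zero_free_extension K g f F))"
proof -
  have "reducible (cont_ring K) f g \<longleftrightarrow> (\<exists>F. zero_free_extension K g f F)"
    if f: "f \<in> (UNIV :: 'n set) \<rightarrow> carrier (cont_ring K)" for f
  proof
    have fc: "continuous_on K (f j)" for j using f by (auto simp: cont_ring_def)
    have gc: "continuous_on K g" using g by (auto simp: cont_ring_def)
    {
      assume "reducible (cont_ring K) f g"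
      then obtain a where a: "\<And>j. continuous_on K (a j)"
        "\<And>t. t \<in> K \<Longrightarrow> \<exists>j. f j t + g t * a j t \<noteq> 0"
        using reducible_cont_ring_iff[OF f g] by blast
      have "continuous_on K (\<lambda>t. \<chi> j. f j t + g t * a j t)"
        by (intro continuous_intros fc gc a)
      then have "zero_free_extension K g f (\<lambda>t. \<chi> j. f j t + g t * a j t)"
        using a(2) by (auto simp: zero_free_extension_def zeros_def vec_eq_iff)
      then show "\<exists>F. zero_free_extension K g f F" by blast
    }
    {
      assume "\<exists>F. zero_free_extension K g f F"
      then obtain F where F: "continuous_on K F" "\<And>x. x \<in> K \<Longrightarrow> F x \<noteq> 0"
        "\<And>x. x \<in> K \<Longrightarrow> g x = 0 \<Longrightarrow> F x = (\<chi> j. f j x)"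
        by (auto simp: zero_free_extension_def zeros_def)
      have fc': "continuous_on K (\<lambda>x. \<chi> j. f j x)" by (intro continuous_intros fc)
      obtain a where a: "continuous_on K a"
        "\<And>x. x \<in> K \<Longrightarrow> (\<chi> j. f j x) + (\<chi> j. g x * a x $ j) \<noteq> 0"
        using exists_zero_free_perturbation[OF K fc' F(1) gc F(2,3)] by blast
      have "continuous_on K (\<lambda>x. a x $ j)" for j
        by (intro continuous_intros a)
      moreover have "\<exists>j. f j x + g x * a x $ j \<noteq> 0" if "x \<in> K" for x
        using a(2)[OF that] by (auto simp: vec_eq_iff)
      ultimately show "reducible (cont_ring K) f g"
        using reducible_cont_ring_iff[OF f g] by (auto intro!: exI[of _ "\<lambda>j x. a x $ j"])
    }
  qed
  then show ?thesis
    unfolding stable_at_def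
    by (intro ball_cong[OF refl]) (simp add: unimodular_case_option_iff[OF _ g])
qed

section \<open>Zero-free extension versus the boundary principle, and the combined result\<close>

text \<open>Tuples of length \<open>n\<close> on a subset of \<open>'k ^ 'n\<close> are maps of a
  Euclidean space into itself, over the reals and the complex numbers alike, so the obstruction and
  the extension result both apply.\<close>

lemma zero_free_extension_iff_boundary_principle:
  fixes K :: "('k ^ 'n) set" and g :: "'k ^ 'n \<Rightarrow> 'k"
  assumes K: "compact K" and g: "continuous_on K g"
  shows "(\<forall>f \<in> (UNIV :: 'n set) \<rightarrow> carrier (cont_ring K).
       tuple_zeros K f \<inter> zeros K g = {} \<longrightarrow> (\<exists>F. zero_free_extension K g f F))
     \<longleftrightarrow> boundary_principle K g" (is "?E \<longleftrightarrow> _")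
proof
  let ?L = "zeros K g"
  have "closed ?L" using closed_zeros[OF K g] .
  moreover have "?L = K \<inter> ?L" by (auto simp: zeros_def)
  ultimately have L: "compact ?L" using compact_Int_closed[OF K] by metis
  {
    assume E: ?E
    show "boundary_principle K g"
      unfolding boundary_principle_def
    proof (intro allI impI ballI, rule ccontr)
      fix G p
      assume G: "open G \<and> G \<noteq> {} \<and> G \<subseteq> K" and fr: "\<forall>x\<in>frontier G. g x = 0"
        and p: "p \<in> G" "g p \<noteq> 0"
      \<comment> \<open>The coordinates of \<open>x - p\<close>. Their only possible common zero is
        \<open>p\<close>, where \<open>g\<close> does not vanish, so the tuple is admissible in the
        extension property.\<close>
      define f where "f j = (\<lambda>x\<in>K. x $ j - p $ j)" for j
      have "f \<in> UNIV \<rightarrow> carrier (cont_ring K)"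
        by (auto simp: f_def cont_ring_def cong: continuous_on_cong intro!: continuous_intros)
      moreover have "tuple_zeros K f \<inter> ?L = {}"
        using p by (auto simp: f_def tuple_zeros_def zeros_def vec_eq_iff[symmetric])
      ultimately obtain F where F: "zero_free_extension K g f F" using E by blast
      have GK: "closure G \<subseteq> K" using G K closure_minimal compact_imp_closed by blast
      show False
      proof (rule no_zero_free_extension_of_translation[of G p F])
        show "bounded G" using G K bounded_subset compact_imp_bounded by blast
        show "continuous_on (closure G) F" "\<And>x. x \<in> closure G \<Longrightarrow> F x \<noteq> 0"
          using F GK by (auto simp: zero_free_extension_def intro: continuous_on_subset)
        fix x assume x: "x \<in> frontier G"
        then have "x \<in> K" using GK by (auto simp: frontier_def)
        then show "F x = x - p"
          using x fr F by (auto simp: zero_free_extension_def zeros_def f_def vec_eq_iff)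
      qed (use G p in auto)
    qed
  }
  {
    assume "boundary_principle K g"
    then have hc: "hole_condition ?L K"
      using boundary_principle_iff_hole_condition[OF K \<open>closed ?L\<close>] by simp
    show ?E
    proof (intro ballI impI)
      fix f :: "'n \<Rightarrow> 'k ^ 'n \<Rightarrow> 'k"
      assume f: "f \<in> UNIV \<rightarrow> carrier (cont_ring K)" and z: "tuple_zeros K f \<inter> ?L = {}"
      have "continuous_on K (f j)" for j using f by (auto simp: cont_ring_def)
      then have fc: "continuous_on K (\<lambda>x. \<chi> j. f j x)" by (intro continuous_intros)
      have f0: "(\<chi> j. f j x) \<noteq> 0" if "x \<in> ?L" for x
        using z that by (auto simp: tuple_zeros_def zeros_def vec_eq_iff)
      have "?L \<subseteq> K" by (auto simp: zeros_def)
      then obtain F where "continuous_on K F" "\<And>x. x \<in> K \<Longrightarrow> F x \<noteq> 0"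
        "\<And>x. x \<in> ?L \<Longrightarrow> F x = (\<chi> j. f j x)"
        using zero_free_extension_if_hole_condition[OF L _ fc f0 hc] by blast
      then have "zero_free_extension K g f F" by (auto simp: zero_free_extension_def)
      then show "\<exists>F. zero_free_extension K g f F" by blast
    qed
  }
qed

lemma stability_characterizations:
  fixes K :: "('k ^ 'n) set" and g :: "'k ^ 'n \<Rightarrow> 'k"
  assumes K: "compact K" and g: "g \<in> carrier (cont_ring K)"
  shows "(stable_at TYPE('n) (cont_ring K) g \<longleftrightarrow>
            (\<forall>f \<in> (UNIV :: 'n set) \<rightarrow> carrier (cont_ring K).
               tuple_zeros K f \<inter> zeros K g = {} \<longrightarrow>
               (\<exists>F. zero_free_extension K g f F))) \<and>
         ((\<forall>f \<in> (UNIV :: 'n set) \<rightarrow> carrier (cont_ring K).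
               tuple_zeros K f \<inter> zeros K g = {} \<longrightarrow>
               (\<exists>F. zero_free_extension K g f F)) \<longleftrightarrow>
            boundary_principle K g) \<and>
         (boundary_principle K g \<longleftrightarrow> hole_condition (zeros K g) K)"
proof -
  have gc: "continuous_on K g" using g by (auto simp: cont_ring_def)
  have "closed (zeros K g)" using closed_zeros[OF K gc] .
  then show ?thesis
    by (intro conjI stable_at_iff_zero_free_extension[OF K g]
        zero_free_extension_iff_boundary_principle[OF K gc]
        boundary_principle_iff_hole_condition[OF K])
qed

end

theorem theorem5p6:
  "(\<forall>(K :: (real ^ 'n) set) (g :: real ^ 'n \<Rightarrow> real).
       compact K \<longrightarrow> g \<in> carrier (cont_ring K) \<longrightarrow>
         (stable_at TYPE('n) (cont_ring K) g \<longleftrightarrow>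
            (\<forall>f \<in> (UNIV :: 'n set) \<rightarrow> carrier (cont_ring K).
               tuple_zeros K f \<inter> zeros K g = {} \<longrightarrow>
               (\<exists>F. zero_free_extension K g f F))) \<and>
         ((\<forall>f \<in> (UNIV :: 'n set) \<rightarrow> carrier (cont_ring K).
               tuple_zeros K f \<inter> zeros K g = {} \<longrightarrow>
               (\<exists>F. zero_free_extension K g f F)) \<longleftrightarrow>
            boundary_principle K g) \<and>
         (boundary_principle K g \<longleftrightarrow> hole_condition (zeros K g) K))
   \<and>
   (\<forall>(K :: (complex ^ 'n) set) (g :: complex ^ 'n \<Rightarrow> complex).
       compact K \<longrightarrow> g \<in> carrier (cont_ring K) \<longrightarrow>
         (stable_at TYPE('n) (cont_ring K) g \<longleftrightarrow>
            (\<forall>f \<in> (UNIV :: 'n set) \<rightarrow> carrier (cont_ring K).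
               tuple_zeros K f \<inter> zeros K g = {} \<longrightarrow>
               (\<exists>F. zero_free_extension K g f F))) \<and>
         ((\<forall>f \<in> (UNIV :: 'n set) \<rightarrow> carrier (cont_ring K).
               tuple_zeros K f \<inter> zeros K g = {} \<longrightarrow>
               (\<exists>F. zero_free_extension K g f F)) \<longleftrightarrow>
            boundary_principle K g) \<and>
         (boundary_principle K g \<longleftrightarrow> hole_condition (zeros K g) K))"
proof -
  interpret re: conjugation "\<lambda>x::real. x"
    by unfold_locales (auto simp: power2_eq_square)
  interpret co: conjugation cnj
    by unfold_locales (simp_all only: complex_norm_square mult.commute[of "cnj _"], intro continuous_intros)
  show ?thesis
    by (intro conjI[OF allI[OF allI] allI[OF allI]] impI
        re.stability_characterizations co.stability_characterizations)
qed

end
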